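(* Let $\mathbf{A} \in \mathsf{CIdInRL}$. Then the collection $\{ B_x \mid x \in A \}$ is a partition of $A$.
   Context: A commutative idempotent involutive residuated lattice is an algebra $\mathbf{A}=\langle A,\wedge,\vee,\cdot,\to,1,0\rangle$ such that $\langle A,\wedge,\vee\rangle$ is a lattice (with lattice order $\leq$), $\langle A,\cdot,1\rangle$ is a commutative monoid with $x\cdot x=x$ for all $x$, residuation holds ($x\cdot y\leq z \iff y\leq x\to z$), and, writing $-x := x\to 0$, one has $-{-}x=x$ for all $x$. The class of these algebras is $\mathsf{CIdInRL}$. The monoidal order is $x\sqsubseteq y :\Leftrightarrow x\cdot y=x$. For $x\in A$ put $1_x := x\vee -x$, $0_x := x\wedge -x$, and $B_x := \{y\in A \mid 0_x\sqsubseteq y\sqsubseteq 1_x\}$. *)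

theory Defs
  imports Main "HOL-Library.Disjoint_Sets"
begin

text \<open>
  Commutative idempotent involutive residuated lattices. The carrier is the whole type; nothing is
  assumed about the constant \<open>0\<close> except involutivity of \<open>x \<mapsto> x \<rightarrow> 0\<close>. In particular \<open>0\<close> need be neither
  the least element nor an absorbing one, \<open>1\<close> need not be the greatest element, and multiplication
  need not be the lattice meet.
\<close>

class cidinrl = lattice + comm_monoid_mult + zero +
  fixes residual :: "'a \<Rightarrow> 'a \<Rightarrow> 'a"  (infixr "\<rightarrow>\<^sub>r" 65)
  assumes mult_idem: "x * x = x"
    and residuation: "x * y \<le> z \<longleftrightarrow> y \<le> x \<rightarrow>\<^sub>r z"
    and involutive: "(x \<rightarrow>\<^sub>r 0) \<rightarrow>\<^sub>r 0 = x"
begin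

definition neg :: "'a \<Rightarrow> 'a" where
  "neg x = x \<rightarrow>\<^sub>r 0"

definition monoidal_le :: "'a \<Rightarrow> 'a \<Rightarrow> bool"  (infix "\<sqsubseteq>" 50) where
  "x \<sqsubseteq> y \<longleftrightarrow> x * y = x"

definition one_at :: "'a \<Rightarrow> 'a" where
  "one_at x = sup x (neg x)"

definition zero_at :: "'a \<Rightarrow> 'a" where
  "zero_at x = inf x (neg x)"

text \<open>The endpoints of \<open>block x\<close> are formed in the lattice order, but the interval between them is
  taken in the monoidal order.\<close>

definition block :: "'a \<Rightarrow> 'a set" where
  "block x = {y. zero_at x \<sqsubseteq> y \<and> y \<sqsubseteq> one_at x}"

end

end

theory Submission
  imports Defs
begin

text \<open>
  Both endpoints of a block have multiplicative descriptions: \<open>0\<^sub>x = x \<cdot> -x\<close> and \<open>1\<^sub>x = -(x \<cdot> -x)\<close>.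
  If \<open>y \<in> B\<^sub>x\<close>, then \<open>1\<^sub>x y = y\<close> gives \<open>1\<^sub>x \<le> 1\<^sub>y\<close>, that is \<open>0\<^sub>y \<le> 0\<^sub>x\<close>. Conversely \<open>0\<^sub>x y = 0\<^sub>x \<le> 0\<close>
  gives \<open>0\<^sub>x \<le> -y\<close>, and \<open>0\<^sub>x \<cdot> -y = 0\<^sub>x 0\<^sub>y \<le> 0\<^sub>x \<le> 0\<close> gives \<open>0\<^sub>x \<le> y\<close>. Hence \<open>0\<^sub>x = 0\<^sub>y\<close>, and a
  block is determined by any of its elements.
\<close>

context cidinrl
begin

lemma neg_neg [simp]: "neg (neg x) = x"
  by (simp add: neg_def involutive)

lemma le_neg_iff: "x \<le> neg y \<longleftrightarrow> x * y \<le> 0"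
  by (simp add: neg_def residuation [symmetric] mult.commute)

lemma le_iff_mult_neg: "x \<le> y \<longleftrightarrow> x * neg y \<le> 0"
  using le_neg_iff [of x "neg y"] by simp

text \<open>By involutivity the residual of \<open>y\<close> and \<open>z\<close> is
  \<open>neg (y * neg z)\<close>, so residuation needs only product and negation.\<close>

lemma mult_le_iff: "x * y \<le> z \<longleftrightarrow> x \<le> neg (y * neg z)"
  using le_iff_mult_neg [of "x * y" z] by (simp add: le_neg_iff mult.assoc)

lemma mult_neg_le_zero: "x * neg x \<le> 0"
  using le_iff_mult_neg [of x x] by simp

lemma mult_left_mono: "x \<le> y \<Longrightarrow> z * x \<le> z * y"
  using order_trans residuation by blast

lemma mult_mono: "x \<le> y \<Longrightarrow> u \<le> v \<Longrightarrow> x * u \<le> y * v"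
  by (metis mult_left_mono mult.commute order_trans)

lemma neg_antimono: "x \<le> y \<Longrightarrow> neg y \<le> neg x"
  by (metis le_iff_mult_neg le_neg_iff mult.commute)

text \<open>The meet is its own square, hence below the product. Conversely, a further factor
  \<open>x\<close> or \<open>neg x\<close> leaves \<open>x * neg x\<close> unchanged and so still
  below \<open>0\<close>.\<close>

lemma zero_at_eq: "zero_at x = x * neg x"
proof (rule order.antisym)
  have "zero_at x * zero_at x \<le> x * neg x"
    unfolding zero_at_def by (rule mult_mono) simp_all
  then show "zero_at x \<le> x * neg x"
    by (simp add: mult_idem)
next
  have "x * neg x \<le> x"
    by (simp add: le_iff_mult_neg [of "x * neg x" x] mult.assoc mult_idem mult_neg_le_zero)
  moreover have "x * neg x \<le> neg x"
    by (metis le_neg_iff mult.assoc mult.commute mult_idem mult_neg_le_zero)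
  ultimately show "x * neg x \<le> zero_at x"
    by (simp add: zero_at_def)
qed

lemma neg_zero_at: "neg (zero_at x) = one_at x"
proof (rule order.antisym)
  have "neg (one_at x) \<le> zero_at x"
    unfolding zero_at_def one_at_def
    using neg_antimono [of x "sup x (neg x)"] neg_antimono [of "neg x" "sup x (neg x)"] by simp
  then show "neg (zero_at x) \<le> one_at x"
    by (metis neg_antimono neg_neg)
next
  show "one_at x \<le> neg (zero_at x)"
    unfolding zero_at_def one_at_def
    using neg_antimono [of "inf x (neg x)" x] neg_antimono [of "inf x (neg x)" "neg x"] by simp
qed

lemma one_at_eq: "one_at x = neg (x * neg x)"
  by (metis neg_zero_at zero_at_eq)

lemma neg_one_at: "neg (one_at x) = zero_at x"
  using neg_zero_at [of x, symmetric] by simp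

lemma zero_at_le_zero: "zero_at x \<le> 0"
  by (simp add: zero_at_eq mult_neg_le_zero)

lemma mult_one_at: "x * one_at x = x"
proof (rule order.antisym)
  \<comment> \<open>Residuating leaves \<open>one_at x \<le> neg (x * neg x)\<close>, an equality by
    \<open>one_at_eq\<close>.\<close>
  show "x * one_at x \<le> x"
    using mult_le_iff [of "one_at x" x x] by (simp add: one_at_eq mult.commute)
  have "x * x \<le> x * one_at x"
    by (rule mult_left_mono) (simp add: one_at_def)
  then show "x \<le> x * one_at x"
    by (simp add: mult_idem)
qed

lemma self_in_block: "x \<in> block x"
proof -
  have "zero_at x * x = zero_at x"
    unfolding zero_at_eq using mult.assoc [of x x "neg x"] mult.commute [of "x * neg x" x]
    by (simp add: mult_idem)
  then show ?thesis
    by (simp add: block_def monoidal_le_def mult_one_at)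
qed

lemma zero_at_cong_block:
  assumes "y \<in> block x"
  shows "zero_at y = zero_at x"
proof (rule order.antisym)
  have zero: "zero_at x * y = zero_at x" and one: "y * one_at x = y"
    using assms by (simp_all add: block_def monoidal_le_def)
  \<comment> \<open>Residuate \<open>one_at x * y \<le> y\<close>: the bound on
    \<open>one_at x\<close> is \<open>neg (y * neg y)\<close>.\<close>
  have "one_at x \<le> one_at y"
    by (metis one mult.commute mult_le_iff one_at_eq order_refl)
  then show below: "zero_at y \<le> zero_at x"
    by (metis neg_antimono neg_one_at)
  have "zero_at x \<le> neg y"
    by (simp add: le_neg_iff zero zero_at_le_zero)
  moreover have "zero_at x \<le> y"
  proof -
    \<comment> \<open>Insert a factor \<open>y\<close>, which \<open>zero_at x\<close> absorbs, to
      form \<open>y * neg y\<close>.\<close>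
    have "zero_at x * neg y = zero_at x * zero_at y"
      by (metis zero zero_at_eq mult.assoc)
    also have "\<dots> \<le> zero_at x"
      using mult_left_mono [OF below, of "zero_at x"] by (simp add: mult_idem)
    finally show ?thesis
      using le_iff_mult_neg order_trans zero_at_le_zero by blast
  qed
  ultimately show "zero_at x \<le> zero_at y"
    by (simp add: zero_at_def [of y])
qed

lemma block_cong:
  assumes "y \<in> block x"
  shows "block y = block x"
  \<comment> \<open>As \<open>one_at\<close> is the negation of \<open>zero_at\<close>, the lower
    endpoint alone fixes the block.\<close>
  unfolding block_def neg_zero_at [symmetric] zero_at_cong_block [OF assms] ..

end

theorem proposition3p4:
  shows "partition_on (UNIV :: 'a::cidinrl set) {block x | x. x \<in> UNIV}"
proof (rule partition_onI)
  show "\<Union> {block x | x :: 'a. x \<in> UNIV} = UNIV"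
    using self_in_block by blast
  show "disjnt p q"
    if "p \<in> {block x | x :: 'a. x \<in> UNIV}" "q \<in> {block x | x :: 'a. x \<in> UNIV}" "p \<noteq> q" for p q
    using that block_cong unfolding disjnt_iff by blast
  show "{} \<notin> {block x | x :: 'a. x \<in> UNIV}"
    using self_in_block by blast
qed

end
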